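(* Let $\lambda\in\mathbb{C}^*$. Then the quandle $M_\lambda$ is $2$-connected.
   Context: A quandle is a non-empty set $Q$ with a binary operation $*$ such that: (Q1) $x*x=x$ for all $x$; (Q2) for all $x,y\in Q$ there is a unique $z\in Q$ with $x=z*y$; (Q3) $(x*y)*z=(x*z)*(y*z)$ for all $x,y,z$. Products without parentheses are left-associated. $Q$ is $1$-connected if $L_x:Q\to Q$, $L_x(y)=x*y$, is surjective for each $x\in Q$. $Q$ is $2$-connected if it is not $1$-connected and for any $x,y\in Q$ there are $1\le l,l'\le 2$ and $z_i,z'_j\in Q$ with $x=y*z_1*\cdots*z_l$ and $y=x*z'_1*\cdots*z'_{l'}$. For $\lambda\in\mathbb{C}^*$, $M_\lambda$ is the conjugacy class in $\operatorname{GL}(2,\mathbb{C})$ of $\begin{pmatrix}\lambda&1\\0&\lambda\end{pmatrix}$, regarded as a quandle with operation $X*Y=Y^{-1}XY$. *)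

theory Defs
  imports "HOL-Analysis.Analysis"
begin

locale quandle =
  fixes Q :: "'a set"
    and op :: "'a \<Rightarrow> 'a \<Rightarrow> 'a"  (infixl "\<triangleright>" 70)
  assumes nonempty: "Q \<noteq> {}"
    and closed: "\<lbrakk>x \<in> Q; y \<in> Q\<rbrakk> \<Longrightarrow> x \<triangleright> y \<in> Q"
    and idem: "x \<in> Q \<Longrightarrow> x \<triangleright> x = x"
    and right_division: "\<lbrakk>x \<in> Q; y \<in> Q\<rbrakk> \<Longrightarrow> \<exists>!z. z \<in> Q \<and> x = z \<triangleright> y"
    and self_distrib:
      "\<lbrakk>x \<in> Q; y \<in> Q; z \<in> Q\<rbrakk> \<Longrightarrow> (x \<triangleright> y) \<triangleright> z = (x \<triangleright> z) \<triangleright> (y \<triangleright> z)"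
begin

definition one_connected :: bool where
  "one_connected \<longleftrightarrow> (\<forall>x\<in>Q. (\<lambda>y. x \<triangleright> y) ` Q = Q)"

end

text \<open>\<open>foldl op y [z1, ..., zl]\<close> is the left-associated product
  \<open>y \<triangleright> z1 \<triangleright> ... \<triangleright> zl\<close>.\<close>

locale two_connected_quandle = quandle +
  assumes not_one_connected: "\<not> one_connected"
    and reachable: "\<lbrakk>x \<in> Q; y \<in> Q\<rbrakk> \<Longrightarrow>
      (\<exists>zs. 1 \<le> length zs \<and> length zs \<le> 2 \<and> set zs \<subseteq> Q \<and> x = foldl op y zs) \<and>
      (\<exists>zs'. 1 \<le> length zs' \<and> length zs' \<le> 2 \<and> set zs' \<subseteq> Q \<and> y = foldl op x zs')"

definition mat_conj :: "complex^2^2 \<Rightarrow> complex^2^2 \<Rightarrow> complex^2^2" where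
  "mat_conj X Y = matrix_inv Y ** X ** Y"

definition jordan_block2 :: "complex \<Rightarrow> complex^2^2" where
  "jordan_block2 c = vector [vector [c, 1], vector [0, c]]"

definition M :: "complex \<Rightarrow> (complex^2^2) set" where
  "M c = {mat_conj (jordan_block2 c) P |P. invertible P}"

end

theory Submission imports Defs begin

text \<open>
  An element of \<open>M l\<close> is \<open>l + N\<close> with \<open>N \<noteq> 0\<close> and \<open>N\<^sup>2 = 0\<close>. Such an \<open>N\<close> has rank one, its image
  equals its kernel, and since every complex number is a square it can be normalised to
  \<open>N x = det(v, x) v\<close> for a vector \<open>v \<noteq> 0\<close> that is unique up to sign. This identifies \<open>M l\<close> with
  the nonzero vectors of the plane modulo sign (\<open>M_eq_parabolic\<close>), and conjugation becomes a
  symplectic transvection (\<open>mat_conj_parabolic\<close>):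
  \<open>v \<triangleright> w = v + (det(v, w) / l) w\<close>.

  The quandle axioms hold for conjugation in any group. For connectedness let \<open>u\<close> and \<open>v\<close> be
  nonzero vectors with \<open>d = det(v, u)\<close>.

  \<^item> If \<open>d \<noteq> 0\<close>, then \<open>u = v \<triangleright> w\<close> for \<open>w = t (u - v)\<close> with \<open>t\<^sup>2 = l / d\<close>, because
    \<open>det(v, w) = t d\<close>. So one step suffices (\<open>one_step\<close>).
  \<^item> If \<open>d = 0\<close>, then \<open>u\<close> is a multiple of \<open>v\<close>, and a vector \<open>m\<close> off their common line
    gives two steps, from \<open>v\<close> to \<open>m\<close> and from \<open>m\<close> to \<open>u\<close> (\<open>two_steps\<close>).

  One step does not always suffice: if \<open>v \<triangleright> w\<close> is a multiple of \<open>v\<close>, then so is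
  \<open>det(v, w) w\<close>, which forces \<open>det(v, w) = 0\<close> and \<open>v \<triangleright> w = v\<close>. In particular \<open>2 v\<close> is not in
  the image of \<open>L\<^sub>v\<close>.
\<close>

section \<open>Conjugation of invertible matrices\<close>

lemma matrix_inv_mult:
  assumes "invertible (Y :: complex^2^2)"
  shows "matrix_inv Y ** Y = mat 1" "Y ** matrix_inv Y = mat 1"
  using someI_ex[OF assms[unfolded invertible_def]] unfolding matrix_inv_def by auto

lemma mat_conj_eq_iff:
  assumes "invertible Y"
  shows "mat_conj X Y = Z \<longleftrightarrow> X ** Y = Y ** Z"
proof
  assume "mat_conj X Y = Z"
  then have "Y ** Z = (Y ** matrix_inv Y) ** X ** Y"
    by (auto simp: mat_conj_def matrix_mul_assoc)
  then show "X ** Y = Y ** Z"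
    by (simp add: matrix_inv_mult[OF assms])
next
  assume "X ** Y = Y ** Z"
  then have "mat_conj X Y = (matrix_inv Y ** Y) ** Z"
    by (simp add: mat_conj_def matrix_mul_assoc[symmetric])
  then show "mat_conj X Y = Z"
    by (simp add: matrix_inv_mult[OF assms])
qed

lemma mat_conj_intertwines:
  assumes "invertible Y"
  shows "X ** Y = Y ** mat_conj X Y"
  using mat_conj_eq_iff[OF assms] by blast

lemma mat_conj_self:
  assumes "invertible X"
  shows "mat_conj X X = X"
  by (simp add: mat_conj_eq_iff[OF assms])

lemma mat_conj_mult:
  assumes "invertible P" "invertible Q"
  shows "mat_conj (mat_conj X P) Q = mat_conj X (P ** Q)"
proof -
  have "X ** (P ** Q) = P ** (mat_conj X P ** Q)"
    by (metis mat_conj_intertwines[OF assms(1)] matrix_mul_assoc)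
  also have "\<dots> = (P ** Q) ** mat_conj (mat_conj X P) Q"
    by (metis mat_conj_intertwines[OF assms(2)] matrix_mul_assoc)
  finally show ?thesis
    by (metis mat_conj_eq_iff invertible_mult assms)
qed

lemma mat_conj_mat_1: "mat_conj X (mat 1) = X"
proof -
  have "invertible (mat 1 :: complex^2^2)"
    by (auto simp: invertible_def)
  then show ?thesis by (simp add: mat_conj_eq_iff)
qed

lemma invertible_matrix_inv:
  assumes "invertible (Y :: complex^2^2)"
  shows "invertible (matrix_inv Y)"
  using matrix_inv_mult[OF assms] unfolding invertible_def by blast

lemma invertible_mat_conj:
  assumes "invertible X" "invertible Y"
  shows "invertible (mat_conj X Y)"
  unfolding mat_conj_def by (intro invertible_mult invertible_matrix_inv assms)

text \<open>Conjugation by \<open>Z\<close> is an automorphism, so it preserves conjugation itself. Computing with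
  \<open>X Z = Z (X \<triangleright> Z)\<close> and its analogues moves \<open>Z\<close> to the left, where it cancels.\<close>

lemma mat_conj_self_distrib:
  assumes "invertible Y" "invertible Z"
  shows "mat_conj (mat_conj X Y) Z = mat_conj (mat_conj X Z) (mat_conj Y Z)"
proof -
  have "mat_conj (mat_conj X Z) (mat_conj Y Z) = mat_conj X (Z ** mat_conj Y Z)"
    by (intro mat_conj_mult invertible_mat_conj assms)
  also have "\<dots> = mat_conj X (Y ** Z)"
    using mat_conj_intertwines[OF assms(2)] by simp
  finally show ?thesis
    by (simp add: mat_conj_mult assms)
qed

section \<open>Nonzero vectors as coordinates on the conjugacy class\<close>

text \<open>The matrix \<open>l + N\<close> where \<open>N x = det((a, b), x) (a, b)\<close>, in coordinates.\<close>

definition parabolic :: "complex \<Rightarrow> complex \<Rightarrow> complex \<Rightarrow> complex^2^2" where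
  "parabolic l a b = vector [vector [l - a * b, a\<^sup>2], vector [- b\<^sup>2, l + a * b]]"

lemma parabolic_nth [simp]:
  "parabolic l a b $ 1 $ 1 = l - a * b" "parabolic l a b $ 1 $ 2 = a\<^sup>2"
  "parabolic l a b $ 2 $ 1 = - b\<^sup>2" "parabolic l a b $ 2 $ 2 = l + a * b"
  by (simp_all add: parabolic_def)

lemma invertible_parabolic:
  assumes "l \<noteq> 0"
  shows "invertible (parabolic l a b)"
proof -
  have "det (parabolic l a b) = l\<^sup>2"
    by (simp add: det_2 algebra_simps power2_eq_square)
  then show ?thesis
    using assms by (simp add: invertible_det_nz)
qed

text \<open>Conjugation by \<open>P\<close> of determinant \<open>D\<close> turns the Jordan block into the matrix of the vector
  \<open>P\<^sup>-\<^sup>1 (1, 0)\<close> scaled by a square root of \<open>D\<close>. Conversely every nonzero vector \<open>v\<close> is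
  \<open>P\<^sup>-\<^sup>1 (1, 0)\<close> for some \<open>P\<close> of determinant \<open>1\<close>.\<close>

lemma M_eq_parabolic: "M l = {parabolic l a b |a b. a \<noteq> 0 \<or> b \<noteq> 0}"
proof (intro equalityI subsetI)
  fix X assume "X \<in> M l"
  then obtain P where P: "invertible P" and X: "X = mat_conj (jordan_block2 l) P"
    by (auto simp: M_def)
  define D where "D = det P"
  have D: "D \<noteq> 0" "D = P$1$1 * P$2$2 - P$1$2 * P$2$1"
    using P by (simp_all add: D_def invertible_det_nz det_2)
  define t where "t = csqrt D"
  have t: "t\<^sup>2 = D" "t \<noteq> 0"
    using D(1) by (auto simp: t_def)
  define a b where "a = P$2$2 / t" and "b = - P$2$1 / t"
  have ab: "a * b = - P$2$2 * P$2$1 / D" "a\<^sup>2 = (P$2$2)\<^sup>2 / D" "b\<^sup>2 = (P$2$1)\<^sup>2 / D"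
    by (simp_all add: a_def b_def t(1)[symmetric] power2_eq_square)
  have "jordan_block2 l ** P = P ** parabolic l a b"
    using D(1) unfolding vec_eq_iff forall_2
    by (simp add: matrix_matrix_mult_def sum_2 jordan_block2_def ab field_simps)
      (simp add: D(2) power2_eq_square algebra_simps)
  then have "X = parabolic l a b"
    by (simp add: X mat_conj_eq_iff[OF P])
  moreover have "a \<noteq> 0 \<or> b \<noteq> 0"
    using D t(2) by (auto simp: a_def b_def)
  ultimately show "X \<in> {parabolic l a b |a b. a \<noteq> 0 \<or> b \<noteq> 0}"
    by blast
next
  fix X assume "X \<in> {parabolic l a b |a b. a \<noteq> 0 \<or> b \<noteq> 0}"
  then obtain a b where ab: "a \<noteq> 0 \<or> b \<noteq> 0" and X: "X = parabolic l a b"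
    by blast
  obtain p q where pq: "p * a + q * b = 1"
  proof (cases "a = 0")
    case True
    then show ?thesis using ab that[of 0 "1 / b"] by simp
  next
    case False
    then show ?thesis using that[of "1 / a" 0] by simp
  qed
  define P :: "complex^2^2" where "P = vector [vector [p, q], vector [- b, a]]"
  have "det P = 1"
    using pq by (simp add: det_2 P_def)
  then have P: "invertible P"
    by (simp add: invertible_det_nz)
  have 1: "- (p * (a * b)) - q * b\<^sup>2 = - b" "p * a\<^sup>2 + q * (a * b) = a"
    using pq by algebra+
  have "jordan_block2 l ** P = P ** parabolic l a b"
    unfolding vec_eq_iff forall_2
    using 1 by (simp add: matrix_matrix_mult_def sum_2 jordan_block2_def P_def)
      (simp add: algebra_simps power2_eq_square)
  then have "mat_conj (jordan_block2 l) P = X"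
    by (simp add: X mat_conj_eq_iff[OF P])
  then show "X \<in> M l"
    using P unfolding M_def by blast
qed

lemma invertible_M:
  assumes "l \<noteq> 0" "X \<in> M l"
  shows "invertible X"
  using assms by (auto simp: M_eq_parabolic invertible_parabolic)

lemma mat_conj_in_M:
  assumes "X \<in> M l" "invertible Y"
  shows "mat_conj X Y \<in> M l"
proof -
  obtain P where P: "invertible P" "X = mat_conj (jordan_block2 l) P"
    using assms(1) by (auto simp: M_def)
  then have "mat_conj X Y = mat_conj (jordan_block2 l) (P ** Y)"
    by (simp add: mat_conj_mult assms(2))
  then show ?thesis
    using invertible_mult[OF P(1) assms(2)] unfolding M_def by blast
qed

text \<open>Conjugation by \<open>Y = l + N\<close> sends the vector \<open>v\<close> to \<open>l Y\<^sup>-\<^sup>1 v\<close>, since \<open>Y / l\<close> has determinant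
  \<open>1\<close>; here \<open>l Y\<^sup>-\<^sup>1 = 1 - N / l\<close> is a transvection.\<close>

lemma mat_conj_parabolic:
  assumes "l \<noteq> 0" and k: "l * k = a * d - b * c"
  shows "mat_conj (parabolic l a b) (parabolic l c d) = parabolic l (a + k * c) (b + k * d)"
proof -
  have "(l - a*b) * (l - c*d) + a\<^sup>2 * (- d\<^sup>2) =
      (l - c*d) * (l - (a + k*c) * (b + k*d)) + c\<^sup>2 * (- (b + k*d)\<^sup>2)"
    "(l - a*b) * c\<^sup>2 + a\<^sup>2 * (l + c*d) =
      (l - c*d) * (a + k*c)\<^sup>2 + c\<^sup>2 * (l + (a + k*c) * (b + k*d))"
    "(- b\<^sup>2) * (l - c*d) + (l + a*b) * (- d\<^sup>2) =
      (- d\<^sup>2) * (l - (a + k*c) * (b + k*d)) + (l + c*d) * (- (b + k*d)\<^sup>2)"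
    "(- b\<^sup>2) * c\<^sup>2 + (l + a*b) * (l + c*d) =
      (- d\<^sup>2) * (a + k*c)\<^sup>2 + (l + c*d) * (l + (a + k*c) * (b + k*d))"
    using k by algebra+
  then have "parabolic l a b ** parabolic l c d =
      parabolic l c d ** parabolic l (a + k * c) (b + k * d)"
    unfolding vec_eq_iff forall_2
    by (simp only: matrix_matrix_mult_def sum_2 parabolic_nth vec_lambda_beta simp_thms)
  then show ?thesis
    by (simp add: mat_conj_eq_iff invertible_parabolic assms(1))
qed

section \<open>Reachability\<close>

lemma one_step:
  assumes "l \<noteq> 0" and "a * d - b * c \<noteq> 0"
  shows "\<exists>W\<in>M l. mat_conj (parabolic l a b) W = parabolic l c d"
proof -
  define t where "t = csqrt (l / (a * d - b * c))"
  have t2: "t\<^sup>2 * (a * d - b * c) = l"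
    using assms(2) by (simp add: t_def)
  then have "t \<noteq> 0"
    using assms(1) by auto
  let ?W = "parabolic l (t * (c - a)) (t * (d - b))"
  have "l * (1 / t) = a * (t * (d - b)) - b * (t * (c - a))"
    using \<open>t \<noteq> 0\<close> by (simp add: t2[symmetric] field_simps power2_eq_square)
  from mat_conj_parabolic[OF assms(1) this]
  have "mat_conj (parabolic l a b) ?W = parabolic l c d"
    using \<open>t \<noteq> 0\<close> by simp
  moreover have "c \<noteq> a \<or> d \<noteq> b"
    using assms(2) by (auto simp: mult.commute)
  then have "?W \<in> M l"
    using \<open>t \<noteq> 0\<close> unfolding M_eq_parabolic by fastforce
  ultimately show ?thesis by blast
qed

lemma two_steps:
  assumes "l \<noteq> 0" and "X \<in> M l" "Y \<in> M l"
  shows "\<exists>zs. 1 \<le> length zs \<and> length zs \<le> 2 \<and> set zs \<subseteq> M l \<and> Y = foldl mat_conj X zs"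
proof -
  obtain a b where ab: "a \<noteq> 0 \<or> b \<noteq> 0" and X: "X = parabolic l a b"
    using assms(2) by (auto simp: M_eq_parabolic)
  obtain c d where cd: "c \<noteq> 0 \<or> d \<noteq> 0" and Y: "Y = parabolic l c d"
    using assms(3) by (auto simp: M_eq_parabolic)
  show ?thesis
  proof (cases "a * d - b * c = 0")
    case False
    then obtain W where "W \<in> M l" "mat_conj X W = Y"
      using one_step[OF assms(1)] X Y by blast
    then show ?thesis
      by (intro exI[of _ "[W]"]) simp
  next
    case True
    \<comment> \<open>a coordinate vector that is not a multiple of \<open>(a, b)\<close>\<close>
    obtain p q where pq: "a * q - b * p \<noteq> 0" "p * d - q * c \<noteq> 0"
    proof (cases "a = 0")
      case a: True
      then have "b \<noteq> 0" "d \<noteq> 0"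
        using ab cd True by auto
      then show ?thesis
        using a that[where p = 1 and q = 0] by simp
    next
      case False
      moreover have "c \<noteq> 0"
        using False cd True by auto
      ultimately show ?thesis using that[where p = 0 and q = 1] by simp
    qed
    obtain V W where "V \<in> M l" "mat_conj X V = parabolic l p q"
      and "W \<in> M l" "mat_conj (parabolic l p q) W = Y"
      using one_step[OF assms(1) pq(1)] one_step[OF assms(1) pq(2)] X Y by blast
    then show ?thesis
      by (intro exI[of _ "[V, W]"]) simp
  qed
qed

text \<open>The vectors \<open>(1, 0)\<close> and \<open>(2, 0)\<close> are parallel but differ by more than a sign. If
  \<open>(1, 0) \<triangleright> (c, d)\<close> equals \<open>\<plusminus>(2, 0)\<close>, its second coordinate \<open>d\<^sup>2 / l\<close> vanishes, so \<open>d = 0\<close> and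
  the transvection fixes \<open>(1, 0)\<close>.\<close>

lemma double_not_in_image:
  assumes "l \<noteq> 0"
  shows "parabolic l 2 0 \<notin> (\<lambda>Y. mat_conj (parabolic l 1 0) Y) ` M l"
proof
  assume "parabolic l 2 0 \<in> (\<lambda>Y. mat_conj (parabolic l 1 0) Y) ` M l"
  then obtain c d where *: "parabolic l 2 0 = mat_conj (parabolic l 1 0) (parabolic l c d)"
    by (auto simp: M_eq_parabolic)
  have "l * (d / l) = 1 * d - 0 * c"
    using assms by simp
  from mat_conj_parabolic[OF assms this]
  have eq: "parabolic l 2 0 = parabolic l (1 + d / l * c) (d / l * d)"
    by (simp add: *)
  have "d = 0"
    using arg_cong[OF eq, of "\<lambda>A. A $ 2 $ 1"] assms by simp
  then show False
    using arg_cong[OF eq, of "\<lambda>A. A $ 1 $ 2"] by simp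
qed

section \<open>The quandle\<close>

lemma quandle_M:
  assumes "l \<noteq> 0"
  shows "quandle (M l) mat_conj"
proof
  have "parabolic l 1 0 \<in> M l"
    unfolding M_eq_parabolic by force
  then show "M l \<noteq> {}" by blast
next
  fix X Y assume X: "X \<in> M l" and Y: "Y \<in> M l"
  note invX = invertible_M[OF assms X] and invY = invertible_M[OF assms Y]
  show "mat_conj X Y \<in> M l"
    by (rule mat_conj_in_M[OF X invY])
  show "mat_conj X X = X"
    by (rule mat_conj_self[OF invX])
  note invY' = invertible_matrix_inv[OF invY]
  show "\<exists>!Z. Z \<in> M l \<and> X = mat_conj Z Y"
  proof
    show "mat_conj X (matrix_inv Y) \<in> M l \<and> X = mat_conj (mat_conj X (matrix_inv Y)) Y"
      by (simp add: mat_conj_in_M X invY invY' mat_conj_mult matrix_inv_mult mat_conj_mat_1)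
  next
    fix Z assume "Z \<in> M l \<and> X = mat_conj Z Y"
    then show "Z = mat_conj X (matrix_inv Y)"
      by (simp add: mat_conj_mult invY invY' matrix_inv_mult mat_conj_mat_1)
  qed
  fix Z assume "Z \<in> M l"
  then show "mat_conj (mat_conj X Y) Z = mat_conj (mat_conj X Z) (mat_conj Y Z)"
    by (intro mat_conj_self_distrib invY invertible_M[OF assms])
qed

theorem theorem4p15:
  fixes l :: complex
  assumes "l \<noteq> 0"
  shows "two_connected_quandle (M l) mat_conj"
proof -
  interpret quandle "M l" mat_conj
    by (rule quandle_M[OF assms])
  show ?thesis
  proof
    have "parabolic l 1 0 \<in> M l" "parabolic l 2 0 \<in> M l"
      unfolding M_eq_parabolic by force+
    then show "\<not> one_connected"
      unfolding one_connected_def using double_not_in_image[OF assms] by blast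
  qed (intro conjI two_steps[OF assms])
qed

end
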